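(* Let $A\in SL(2,\mathbb Q)$ have trace $q$, let $p$ be an odd prime with $p\notin\mathcal D(q)$ such that all entries of $A$ have denominators not divisible by $p$, and let $\delta=q^2-4$. If $(\delta|p)\ne0$ then $A^{\frac{p-(\delta|p)}{2}}\equiv(q+2|p)\,I \pmod p$. If $(\delta|p)=0$ then $A^p\equiv\frac q2 I\equiv\pm I\pmod p$.
   Context: For a rational $q=a/b$ in lowest terms, $\mathcal D(q)$ is the set of prime divisors of $b$; congruences mod $p$ of rationals (or matrices of rationals) whose denominators are prime to $p$ mean equality of their images in $\mathbb F_p$. Legendre symbol of a rational $x=a/b$ (lowest terms) at an odd prime $p\nmid b$: $(x|p)=1$ if $ab$ is a nonzero quadratic residue mod $p$, $(x|p)=-1$ if $ab$ is a quadratic nonresidue mod $p$, and $(x|p)=0$ if $p\mid a$. *)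

theory Defs
  imports
    "HOL-Analysis.Analysis"
    "HOL-Number_Theory.Number_Theory"
begin

definition denom_primes :: "rat \<Rightarrow> nat set" where
  "denom_primes x = {p. prime p \<and> int p dvd snd (quotient_of x)}"

text \<open>
  The image of a rational number \<open>a/b\<close> (in lowest terms, \<open>b\<close> prime to \<open>p\<close>) in the prime field,
  whose elements are represented by \<open>{0..<p}\<close>. The value is meaningless if \<open>p\<close> divides \<open>b\<close>;
  the congruence below therefore demands \<open>p\<close>-integrality of both sides explicitly.
\<close>
definition rat_residue :: "nat \<Rightarrow> rat \<Rightarrow> int" where
  "rat_residue p x =
     (case quotient_of x of (a, b) \<Rightarrow> (a * modular_inverse (int p) b) mod int p)"

definition rat_cong :: "nat \<Rightarrow> rat \<Rightarrow> rat \<Rightarrow> bool" where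
  "rat_cong p x y \<longleftrightarrow>
     p \<notin> denom_primes x \<and> p \<notin> denom_primes y \<and> rat_residue p x = rat_residue p y"

definition mat_cong :: "nat \<Rightarrow> rat^'n^'m \<Rightarrow> rat^'n^'m \<Rightarrow> bool" where
  "mat_cong p M N \<longleftrightarrow> (\<forall>i j. rat_cong p (M $ i $ j) (N $ i $ j))"

text \<open>Only meaningful for odd primes \<open>p\<close> not dividing the denominator of \<open>x\<close>.\<close>
definition rat_Legendre :: "rat \<Rightarrow> nat \<Rightarrow> int" where
  "rat_Legendre x p = (case quotient_of x of (a, b) \<Rightarrow> Legendre (a * b) (int p))"

definition matrix_power :: "'a::semiring_1^'n^'n \<Rightarrow> nat \<Rightarrow> 'a^'n^'n" where
  "matrix_power A k = ((\<lambda>B. A ** B) ^^ k) (mat 1)"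

end

theory Submission
  imports Defs
begin

text \<open>
  By Cayley--Hamilton, \<open>A\<close> modulo \<open>p\<close> is the image of \<open>x\<close> in the commutative ring
  \<open>\<int>[x] / (p, x\<^sup>2 - Q x + 1)\<close>, where the integer \<open>Q\<close> represents the trace. There the
  Frobenius map sends \<open>x\<close> to \<open>x\<close>, to \<open>Q - x\<close> or to \<open>Q / 2\<close>, according to the Legendre
  symbol of \<open>Q\<^sup>2 - 4\<close>, and the half powers follow from \<open>(x + 1)\<^sup>2 = (Q + 2) x\<close>.
\<close>

section \<open>Residues of rational numbers\<close>

text \<open>The fraction need not be in lowest terms and \<open>a\<close> may be any representative
  of the class. Sums and products then follow from formal fraction arithmetic, without reducing the
  results.\<close>

definition has_residue :: "nat \<Rightarrow> rat \<Rightarrow> int \<Rightarrow> bool" where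
  "has_residue p x a \<longleftrightarrow>
     (\<exists>n d. x = of_int n / of_int d \<and> coprime d (int p) \<and> [n = a * d] (mod int p))"

lemma coprime_prime_nonzero: "prime p \<Longrightarrow> coprime d (int p) \<Longrightarrow> d \<noteq> 0"
  by auto

lemma has_residue_of_int: "has_residue p (of_int a) a"
  unfolding has_residue_def by (rule exI[of _ a], rule exI[of _ 1]) auto

lemma has_residue_add:
  assumes "prime p" "has_residue p x a" "has_residue p y b"
  shows "has_residue p (x + y) (a + b)"
proof -
  obtain n d where 1: "x = of_int n / of_int d" "coprime d (int p)" "[n = a * d] (mod int p)"
    using assms(2) unfolding has_residue_def by blast
  obtain m e where 2: "y = of_int m / of_int e" "coprime e (int p)" "[m = b * e] (mod int p)"
    using assms(3) unfolding has_residue_def by blast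
  have "d \<noteq> 0" "e \<noteq> 0" using 1 2 assms(1) coprime_prime_nonzero by blast+
  then have "x + y = of_int (n * e + m * d) / of_int (d * e)"
    using 1 2 by (simp add: field_simps)
  moreover have "[n * e + m * d = (a * d) * e + (b * e) * d] (mod int p)"
    using 1 2 by (intro cong_add cong_mult) auto
  then have "[n * e + m * d = (a + b) * (d * e)] (mod int p)"
    by (simp add: algebra_simps)
  ultimately show ?thesis unfolding has_residue_def
    using 1(2) 2(2) by (metis coprime_mult_left_iff)
qed

lemma has_residue_mult:
  assumes "has_residue p x a" "has_residue p y b"
  shows "has_residue p (x * y) (a * b)"
proof -
  obtain n d where 1: "x = of_int n / of_int d" "coprime d (int p)" "[n = a * d] (mod int p)"
    using assms(1) unfolding has_residue_def by blast
  obtain m e where 2: "y = of_int m / of_int e" "coprime e (int p)" "[m = b * e] (mod int p)"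
    using assms(2) unfolding has_residue_def by blast
  have "x * y = of_int (n * m) / of_int (d * e)"
    using 1 2 by simp
  moreover have "[n * m = (a * d) * (b * e)] (mod int p)"
    using 1 2 by (intro cong_mult) auto
  then have "[n * m = (a * b) * (d * e)] (mod int p)"
    by (simp add: algebra_simps)
  ultimately show ?thesis unfolding has_residue_def
    using 1(2) 2(2) by (metis coprime_mult_left_iff)
qed

lemma has_residue_cong:
  assumes "has_residue p x a" "[a = b] (mod int p)"
  shows "has_residue p x b"
proof -
  obtain n d where 1: "x = of_int n / of_int d" "coprime d (int p)" "[n = a * d] (mod int p)"
    using assms(1) unfolding has_residue_def by blast
  have "[a * d = b * d] (mod int p)" using assms(2) by (intro cong_mult) auto
  then have "[n = b * d] (mod int p)" using 1(3) cong_trans by blast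
  then show ?thesis unfolding has_residue_def using 1 by blast
qed

lemma has_residue_diff:
  assumes "prime p" "has_residue p x a" "has_residue p y b"
  shows "has_residue p (x - y) (a - b)"
  using has_residue_add[OF assms(1,2) has_residue_mult[OF has_residue_of_int[of p "-1"] assms(3)]]
  by simp

text \<open>Passage from an arbitrary fraction to the reduced one: by coprimality the reduced
  denominator \<open>b\<close> divides \<open>d\<close>, so it is prime to \<open>p\<close> as well,
  and the unit \<open>d\<close> cancels from the cross-multiplied congruence.\<close>

lemma has_residue_quotient_of:
  assumes "prime p" "has_residue p x c" "quotient_of x = (a, b)"
  shows "coprime b (int p)" "[a = c * b] (mod int p)"
proof -
  obtain n d where 1: "x = of_int n / of_int d" "coprime d (int p)" "[n = c * d] (mod int p)"
    using assms(2) unfolding has_residue_def by blast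
  have ab: "b > 0" "coprime a b" "x = of_int a / of_int b"
    using assms(3) quotient_of_denom_pos quotient_of_coprime quotient_of_div by blast+
  have "d \<noteq> 0" using 1 assms(1) coprime_prime_nonzero by blast
  then have "of_int (a * d) = (of_int (n * b) :: rat)"
    using 1 ab by (simp add: field_simps)
  then have eq: "a * d = n * b" using of_int_eq_iff by blast
  then have "b dvd d" using ab(2)
    by (metis coprime_commute coprime_dvd_mult_right_iff dvd_triv_right)
  then show "coprime b (int p)" using 1(2) by (meson coprime_divisors dvd_refl)
  have "[n * b = c * d * b] (mod int p)" using 1(3) by (intro cong_mult) auto
  then have "[a * d = (c * b) * d] (mod int p)" using eq by (simp add: ac_simps)
  then show "[a = c * b] (mod int p)" using 1(2) cong_mult_rcancel by blast
qed

text \<open>Links the relational residue to \<open>denom_primes\<close> and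
  \<open>rat_residue\<close>; congruences of rationals thereby reduce to exhibiting a common integer
  residue.\<close>

lemma rat_residue_eq:
  assumes "prime p" "has_residue p x c"
  shows "p \<notin> denom_primes x" "rat_residue p x = c mod int p"
proof -
  obtain a b where q: "quotient_of x = (a, b)" by fastforce
  note ab = has_residue_quotient_of[OF assms q]
  have "\<not> int p dvd b"
    using ab(1) assms(1) by (metis coprime_absorb_right not_prime_unit prime_nat_int_transfer)
  then show "p \<notin> denom_primes x" by (simp add: denom_primes_def q)
  have "[a * modular_inverse (int p) b = (c * b) * modular_inverse (int p) b] (mod int p)"
    using ab(2) by (intro cong_mult) auto
  also have "(c * b) * modular_inverse (int p) b = c * (b * modular_inverse (int p) b)"
    by simp
  also have "[c * (b * modular_inverse (int p) b) = c * 1] (mod int p)"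
    using ab(1) by (intro cong_mult cong_modular_inverse1) auto
  finally show "rat_residue p x = c mod int p"
    by (simp add: rat_residue_def q cong_def)
qed

lemma has_residue_unique:
  assumes "prime p" "has_residue p x a" "has_residue p x b"
  shows "[a = b] (mod int p)"
  using rat_residue_eq[OF assms(1,2)] rat_residue_eq[OF assms(1,3)] by (simp add: cong_def)

lemma has_residue_exists:
  assumes "prime p" "p \<notin> denom_primes x"
  shows "\<exists>c. has_residue p x c"
proof -
  obtain a b where q: "quotient_of x = (a, b)" by fastforce
  have "coprime b (int p)"
    using assms q prime_imp_coprime[of "int p" b] by (auto simp: denom_primes_def coprime_commute)
  moreover have "[a = (a * modular_inverse (int p) b) * b] (mod int p)"
  proof -
    have "[a * (modular_inverse (int p) b * b) = a * 1] (mod int p)"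
      using calculation by (intro cong_mult cong_modular_inverse2) auto
    then show ?thesis by (simp add: cong_sym ac_simps)
  qed
  ultimately show ?thesis unfolding has_residue_def using quotient_of_div[OF q] by blast
qed

lemma rat_congI:
  assumes "prime p" "has_residue p x a" "has_residue p y a"
  shows "rat_cong p x y"
  using rat_residue_eq[OF assms(1,2)] rat_residue_eq[OF assms(1,3)] by (simp add: rat_cong_def)

text \<open>Twice \<open>(p + 1) div 2\<close> is \<open>p + 1\<close>, so this integer inverts 2
  modulo \<open>p\<close>. The witness -1 comes from \<open>1 - (p + 1) = -p\<close>.\<close>

lemma has_residue_half:
  assumes "odd p" "has_residue p x a"
  shows "has_residue p (x / 2) (a * ((int p + 1) div 2))"
proof -
  obtain k where k: "p = 2 * k + 1" using assms(1) oddE by blast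
  have "has_residue p (1 / 2) ((int p + 1) div 2)"
    unfolding has_residue_def
    by (rule exI[of _ 1], rule exI[of _ 2])
      (use k in \<open>auto simp: cong_iff_dvd_diff intro: dvdI[of _ _ "-1"]\<close>)
  from has_residue_mult[OF assms(2) this] show ?thesis by simp
qed

text \<open>Since \<open>a * b\<close> is congruent to \<open>c * b\<^sup>2\<close> and
  \<open>b\<close> is a unit, the two sides differ by the square of a unit: a root of one is turned
  into a root of the other by multiplying with \<open>b\<close> or its inverse.\<close>

lemma QuadRes_cong_mult_square:
  assumes "coprime b p" "[a = c * b] (mod p)"
  shows "QuadRes p (a * b) \<longleftrightarrow> QuadRes p c"
proof -
  have ab: "[a * b = c * b\<^sup>2] (mod p)"
    using cong_mult[OF assms(2) cong_refl[of b]] by (simp add: power2_eq_square ac_simps)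
  show ?thesis
  proof
    assume "QuadRes p c"
    then obtain y where "[y\<^sup>2 = c] (mod p)" unfolding QuadRes_def by blast
    from cong_trans[OF cong_mult[OF this cong_refl[of "b\<^sup>2"]] cong_sym[OF ab]]
    have "[(y * b)\<^sup>2 = a * b] (mod p)" by (simp add: power_mult_distrib)
    then show "QuadRes p (a * b)" unfolding QuadRes_def by blast
  next
    assume "QuadRes p (a * b)"
    then obtain y where y: "[y\<^sup>2 = a * b] (mod p)" unfolding QuadRes_def by blast
    define i where "i = modular_inverse p b"
    have i: "[b * i = 1] (mod p)" unfolding i_def using assms(1) by (rule cong_modular_inverse1)
    have "[y\<^sup>2 * i\<^sup>2 = c * b\<^sup>2 * i\<^sup>2] (mod p)"
      using cong_trans[OF y ab] by (intro cong_mult) auto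
    moreover have "[c * (b * i)\<^sup>2 = c * 1\<^sup>2] (mod p)"
      using i by (intro cong_mult cong_pow) auto
    ultimately have "[(y * i)\<^sup>2 = c] (mod p)"
      by (metis cong_trans mult.assoc mult.right_neutral one_power2 power_mult_distrib)
    then show "QuadRes p c" unfolding QuadRes_def by blast
  qed
qed

text \<open>Replaces the symbol of a rational, which is computed from numerator times denominator,
  by the integer symbol of any residue.\<close>

lemma rat_Legendre_eq:
  assumes "prime p" "has_residue p x c"
  shows "rat_Legendre x p = Legendre c (int p)"
proof -
  obtain a b where q: "quotient_of x = (a, b)" by fastforce
  note ab = has_residue_quotient_of[OF assms q]
  have ndvd: "\<not> int p dvd b"
    using ab(1) assms(1) by (metis coprime_absorb_right not_prime_unit prime_nat_int_transfer)
  have "int p dvd a \<longleftrightarrow> int p dvd c * b"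
    using ab(2) cong_dvd_iff by blast
  then have "int p dvd a * b \<longleftrightarrow> int p dvd c"
    using ndvd assms(1) by (simp add: prime_dvd_mult_iff)
  then show ?thesis
    using QuadRes_cong_mult_square[OF ab]
    by (simp add: rat_Legendre_def q Legendre_def cong_0_iff)
qed

section \<open>Powers of an element with a quadratic equation modulo a prime\<close>

text \<open>Additivity of the Frobenius map: \<open>p\<close> divides every binomial coefficient
  strictly between the two ends. It is phrased by divisibility because the ring itself need not have
  characteristic \<open>p\<close>.\<close>

lemma prime_dvd_power_add_diff:
  fixes a b :: "'a::comm_ring_1"
  assumes "prime p"
  shows "of_nat p dvd (a + b) ^ p - (a ^ p + b ^ p)"
proof -
  have p: "p > 0" using assms prime_gt_0_nat by blast
  let ?g = "\<lambda>k. of_nat (p choose k) * a ^ k * b ^ (p - k)"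
  have "{..p} = insert 0 (insert p {0<..<p})" using p by auto
  then have "(a + b) ^ p = a ^ p + b ^ p + sum ?g {0<..<p}"
    unfolding binomial_ring using p by simp
  moreover have "of_nat p dvd sum ?g {0<..<p}"
  proof (rule dvd_sum)
    fix k assume "k \<in> {0<..<p}"
    then have "p dvd (p choose k)"
      using assms by (intro dvd_choose_prime) auto
    then have "(of_nat p :: 'a) dvd of_nat (p choose k)"
      by (metis dvd_def of_nat_mult)
    then show "of_nat p dvd ?g k" by (simp add: dvd_mult2 mult.assoc)
  qed
  ultimately show ?thesis by simp
qed

text \<open>Equality in the quotient by the ideal generated by \<open>m\<close> and
  \<open>f\<close>. Working with this relation avoids constructing the quotient ring.\<close>

definition cong_ideal2 :: "'a::comm_ring_1 \<Rightarrow> 'a \<Rightarrow> 'a \<Rightarrow> 'a \<Rightarrow> bool" where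
  "cong_ideal2 m f y z \<longleftrightarrow> (\<exists>h k. y - z = m * h + f * k)"

lemma cong_ideal2_refl: "cong_ideal2 m f y y"
  unfolding cong_ideal2_def by (rule exI[of _ 0], rule exI[of _ 0]) simp

lemma cong_ideal2_dvd1: "m dvd y - z \<Longrightarrow> cong_ideal2 m f y z"
  unfolding cong_ideal2_def dvd_def by (metis add.right_neutral mult_zero_right)

lemma cong_ideal2_dvd2: "f dvd y - z \<Longrightarrow> cong_ideal2 m f y z"
  unfolding cong_ideal2_def dvd_def by (metis add.left_neutral mult_zero_right)

lemma cong_ideal2_add:
  assumes "cong_ideal2 m f y z" "cong_ideal2 m f y' z'"
  shows "cong_ideal2 m f (y + y') (z + z')"
proof -
  obtain h k h' k' where "y - z = m * h + f * k" "y' - z' = m * h' + f * k'"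
    using assms unfolding cong_ideal2_def by blast
  then have "(y + y') - (z + z') = m * (h + h') + f * (k + k')" by (simp add: algebra_simps)
  then show ?thesis unfolding cong_ideal2_def by blast
qed

lemma cong_ideal2_cmult:
  assumes "cong_ideal2 m f y z"
  shows "cong_ideal2 m f (c * y) (c * z)"
proof -
  obtain h k where "y - z = m * h + f * k" using assms unfolding cong_ideal2_def by blast
  then have "c * y - c * z = m * (c * h) + f * (c * k)"
    by (metis (no_types, opaque_lifting) distrib_left mult.left_commute right_diff_distrib')
  then show ?thesis unfolding cong_ideal2_def by blast
qed

lemma cong_ideal2_sym: "cong_ideal2 m f y z \<Longrightarrow> cong_ideal2 m f z y"
  using cong_ideal2_add[OF cong_ideal2_cmult[of m f y z "-1"] cong_ideal2_refl[of m f "y + z"]]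
  by simp

lemma cong_ideal2_trans [trans]:
  assumes "cong_ideal2 m f x y" "cong_ideal2 m f y z"
  shows "cong_ideal2 m f x z"
  \<comment> \<open>The sum of the two congruences relates \<open>x + y\<close> to
    \<open>y + z\<close>; adding \<open>-y\<close> removes the middle term.\<close>
  using cong_ideal2_add[OF assms] cong_ideal2_add[OF _ cong_ideal2_refl[of m f "-y"]] by force

lemma cong_ideal2_mult:
  assumes "cong_ideal2 m f y z" "cong_ideal2 m f y' z'"
  shows "cong_ideal2 m f (y * y') (z * z')"
  using cong_ideal2_trans[OF cong_ideal2_cmult[OF assms(2), of y] ]
    cong_ideal2_cmult[OF assms(1), of z'] by (simp add: mult.commute)

lemma cong_ideal2_power:
  "cong_ideal2 m f y z \<Longrightarrow> cong_ideal2 m f (y ^ n) (z ^ n)"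
  by (induction n) (auto intro: cong_ideal2_refl cong_ideal2_mult)

lemma cong_ideal2_of_int:
  assumes "[a = b] (mod m)"
  shows "cong_ideal2 (of_int m) f (of_int a) (of_int b)"
proof -
  have "m dvd a - b" using assms cong_iff_dvd_diff by blast
  then have "(of_int m :: 'a) dvd of_int (a - b)" by (metis dvd_def of_int_mult)
  then show ?thesis by (intro cong_ideal2_dvd1) simp
qed

text \<open>An integer prime to \<open>m\<close> has an inverse \<open>i\<close> modulo
  \<open>m\<close>, and multiplying by \<open>i\<close> undoes the factor \<open>c\<close>. It
  serves to cancel 2 and \<open>Q + 2\<close> below.\<close>

lemma cong_ideal2_cancel:
  assumes "coprime c m" "cong_ideal2 (of_int m) f (of_int c * y) (of_int c * z)"
  shows "cong_ideal2 (of_int m) f y z"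
proof -
  obtain i where i: "[c * i = 1] (mod m)"
    using assms(1) cong_solve_coprime_int by blast
  have *: "cong_ideal2 (of_int m) f (of_int i * (of_int c * w)) w" for w
    using cong_ideal2_cmult[OF cong_ideal2_of_int[OF i, of f], of w] by (simp add: ac_simps)
  show ?thesis
    using cong_ideal2_trans[OF cong_ideal2_trans[OF cong_ideal2_sym[OF *]
      cong_ideal2_cmult[OF assms(2), of "of_int i"]] *] .
qed

section \<open>Legendre symbols and Fermat's little theorem over the integers\<close>

lemma Legendre_square:
  assumes "\<not> p dvd a"
  shows "Legendre a p * Legendre a p = 1"
  using assms by (simp add: Legendre_def cong_0_iff)

lemma Legendre_eq_0_iff: "Legendre a p = 0 \<longleftrightarrow> p dvd a"
  by (simp add: Legendre_def cong_0_iff)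

text \<open>The case of natural numbers settles absolute values; as \<open>p\<close> is odd, a sign
  passes through the \<open>p\<close>-th power.\<close>

lemma fermat_theorem_int:
  assumes "prime p" "odd p"
  shows "[a ^ p = a] (mod int p)"
proof -
  have "[int (nat \<bar>b\<bar>) ^ p = int (nat \<bar>b\<bar>)] (mod int p)" for b
  proof (cases "p dvd nat \<bar>b\<bar>")
    case True
    then have "int p dvd int (nat \<bar>b\<bar>)" using of_nat_dvd_iff by blast
    moreover have "p > 0" using assms(1) prime_gt_0_nat by blast
    ultimately show ?thesis
      by (metis cong_iff_dvd_diff dvd_diff dvd_power dvd_trans)
  next
    case False
    then have "[nat \<bar>b\<bar> * nat \<bar>b\<bar> ^ (p - 1) = nat \<bar>b\<bar> * 1] (mod p)"
      using fermat_theorem[OF assms(1)] by (intro cong_mult) auto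
    moreover have "nat \<bar>b\<bar> * nat \<bar>b\<bar> ^ (p - 1) = nat \<bar>b\<bar> ^ p"
      using assms(2) by (metis odd_pos power_eq_if less_numeral_extra(3))
    ultimately have "[nat \<bar>b\<bar> ^ p = nat \<bar>b\<bar>] (mod p)" by simp
    then show ?thesis by (metis cong_int_iff of_nat_power)
  qed
  from this[of a] have "[\<bar>a\<bar> ^ p = \<bar>a\<bar>] (mod int p)" by simp
  then show ?thesis
    using assms(2) by (cases "a \<ge> 0") (auto simp: cong_minus_minus_iff)
qed

text \<open>
  Completing the square gives \<open>(2x - Q)\<^sup>2 = Q\<^sup>2 - 4\<close>, so the Frobenius map
  multiplies \<open>2x - Q\<close> by the Legendre symbol of \<open>Q\<^sup>2 - 4\<close>.
\<close>
lemma quadratic_frobenius: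
  fixes x :: "'a::comm_ring_1" and Q :: int
  assumes p: "prime p" "odd p"
  defines "f \<equiv> x\<^sup>2 - of_int Q * x + 1"
  defines "e \<equiv> Legendre (Q\<^sup>2 - 4) (int p)"
  shows "cong_ideal2 (of_int (int p)) f (2 * x ^ p) (of_int Q + of_int e * (2 * x - of_int Q))"
proof -
  let ?C = "cong_ideal2 (of_int (int p)) f"
  obtain k where k: "p = 2 * k + 1" using p(2) oddE by blast
  have "p > 2" using p by (metis prime_ge_2_nat le_neq_implies_less even_numeral)
  then have euler: "[(Q\<^sup>2 - 4) ^ k = e] (mod int p)"
    using euler_criterion[of p "Q\<^sup>2 - 4"] p(1) k e_def by (simp add: cong_sym)
  define N where "N = 2 * x - of_int Q"
  have "N\<^sup>2 - of_int (Q\<^sup>2 - 4) = f * 4"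
    unfolding N_def f_def by (simp add: power2_eq_square algebra_simps)
  then have "?C (N\<^sup>2) (of_int (Q\<^sup>2 - 4))" by (intro cong_ideal2_dvd2) simp
  then have "?C ((N\<^sup>2) ^ k) (of_int (Q\<^sup>2 - 4) ^ k)" by (rule cong_ideal2_power)
  also have "of_int (Q\<^sup>2 - 4) ^ k = (of_int ((Q\<^sup>2 - 4) ^ k) :: 'a)" by simp
  also have "?C (of_int ((Q\<^sup>2 - 4) ^ k)) (of_int e)" by (rule cong_ideal2_of_int[OF euler])
  finally have "?C (N * (N\<^sup>2) ^ k) (N * of_int e)" by (rule cong_ideal2_cmult)
  then have Np: "?C (N ^ p) (of_int e * N)"
    unfolding power_mult[symmetric] by (simp add: k mult.commute)
  \<comment> \<open>Here \<open>2 * x = N + Q\<close>, so the power splits additively; Fermat's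
    theorem then fixes \<open>Q\<close>, and further down it replaces \<open>2 ^ p\<close> by
    2.\<close>
  have "?C ((2 * x) ^ p) (N ^ p + of_int Q ^ p)"
    using prime_dvd_power_add_diff[OF p(1), of N "of_int Q"]
    by (intro cong_ideal2_dvd1) (simp add: N_def)
  also have "?C (N ^ p + of_int Q ^ p) (of_int e * N + of_int Q)"
    using cong_ideal2_of_int[OF fermat_theorem_int[OF p], of f Q]
    by (intro cong_ideal2_add[OF Np]) simp
  finally have "?C ((2 * x) ^ p) (of_int e * N + of_int Q)" .
  moreover have "?C ((2 * x) ^ p) (2 * x ^ p)"
    using cong_ideal2_cmult[OF cong_ideal2_of_int[OF fermat_theorem_int[OF p], of f 2], of "x ^ p"]
    by (simp add: power_mult_distrib mult.commute)
  ultimately show ?thesis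
    unfolding N_def using cong_ideal2_trans cong_ideal2_sym by (metis add.commute)
qed

text \<open>
  The relation \<open>(x + 1)\<^sup>2 = (Q + 2) x\<close> turns the half power of \<open>x\<close> into \<open>(x + 1) ^ (p - e)\<close>,
  which the Frobenius map evaluates.
\<close>
lemma quadratic_half_power:
  fixes x :: "'a::comm_ring_1" and Q :: int
  assumes p: "prime p" "odd p"
  defines "f \<equiv> x\<^sup>2 - of_int Q * x + 1"
  defines "e \<equiv> Legendre (Q\<^sup>2 - 4) (int p)"
  assumes e0: "e \<noteq> 0"
  shows "cong_ideal2 (of_int (int p)) f (x ^ nat ((int p - e) div 2))
           (of_int (Legendre (Q + 2) (int p)))"
proof -
  let ?C = "cong_ideal2 (of_int (int p)) f"
  define s where "s = Legendre (Q + 2) (int p)"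
  obtain k where k: "p = 2 * k + 1" using p(2) oddE by blast
  have "p > 2" using p by (metis prime_ge_2_nat le_neq_implies_less even_numeral)
  then have euler: "[(Q + 2) ^ k = s] (mod int p)"
    using euler_criterion[of p "Q + 2"] p(1) k s_def by (simp add: cong_sym)
  \<comment> \<open>A nonzero symbol \<open>e\<close> excludes \<open>p\<close> from both factors,
    which makes \<open>Q + 2\<close> a unit modulo \<open>p\<close>.\<close>
  have "Q\<^sup>2 - 4 = (Q + 2) * (Q - 2)" by (simp add: power2_eq_square algebra_simps)
  then have nd: "\<not> int p dvd Q + 2"
    using e0 unfolding e_def Legendre_eq_0_iff by (metis dvd_mult2)
  then have cop: "coprime (Q + 2) (int p)"
    using p(1) by (simp add: coprime_commute prime_imp_coprime)
  have cop2: "coprime 2 (int p)" using p(2) by simp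
  have ss: "s * s = 1" unfolding s_def using nd by (rule Legendre_square)
  have frob: "?C (2 * x ^ p) (of_int Q + of_int e * (2 * x - of_int Q))"
    using quadratic_frobenius[OF p, where x = x and Q = Q] unfolding f_def e_def .
  have "?C ((x + 1)\<^sup>2) (of_int (Q + 2) * x)"
    by (rule cong_ideal2_dvd2) (simp add: f_def power2_eq_square algebra_simps)
  then have sq: "?C ((x + 1) ^ (2 * j)) (of_int ((Q + 2) ^ j) * x ^ j)" for j
    using cong_ideal2_power[of _ f _ _ j] by (force simp: power_mult power_mult_distrib)
  have dream: "?C ((x + 1) ^ p) (x ^ p + 1)"
    using prime_dvd_power_add_diff[OF p(1), of x 1] by (intro cong_ideal2_dvd1) simp
  \<comment> \<open>The conjugate root of \<open>f\<close> is \<open>Q - x\<close>, so this is the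
    norm of \<open>x + 1\<close>; the product equals \<open>Q + 2 - f\<close>, whence the factor
    -1.\<close>
  have norm: "?C ((x + 1) * (of_int Q - x + 1)) (of_int (Q + 2))"
    by (rule cong_ideal2_dvd2, rule dvdI[of _ _ "-1"])
      (simp add: f_def power2_eq_square algebra_simps)
  \<comment> \<open>The sign \<open>s\<close> is its own inverse, so it can be moved to the other
    side.\<close>
  have key: "?C (of_int s * x ^ j) 1 \<Longrightarrow> ?C (x ^ j) (of_int s)" for j
    using cong_ideal2_cmult[of _ f "of_int s * x ^ j" 1 "of_int s"] ss
    by (metis (no_types, lifting) mult.assoc mult.right_neutral mult_1 of_int_1 of_int_mult)
  have red: "?C (of_int s * y) (of_int ((Q + 2) ^ k) * y)" for y
    by (rule cong_ideal2_mult[OF cong_ideal2_of_int[OF cong_sym[OF euler]] cong_ideal2_refl])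
  have "e = 1 \<or> e = -1" using e0 by (simp add: e_def Legendre_def split: if_splits)
  then show ?thesis
  proof
    \<comment> \<open>Frobenius fixes \<open>x\<close>, hence also \<open>x + 1\<close>. Multiplying
      by the conjugate turns one factor \<open>x + 1\<close> into the unit \<open>Q + 2\<close>,
      which can be cancelled, so that \<open>(x + 1) ^ (p - 1)\<close> becomes 1.\<close>
    assume e: "e = 1"
    have "?C (x ^ p) x"
      using frob by - (rule cong_ideal2_cancel[OF cop2], simp add: e)
    from cong_ideal2_trans[OF dream cong_ideal2_add[OF this cong_ideal2_refl]]
    have "?C ((x + 1) ^ p) (x + 1)" .
    then have "?C ((of_int Q - x + 1) * (x + 1) ^ p) ((of_int Q - x + 1) * (x + 1))"
      by (rule cong_ideal2_cmult)
    then have "?C ((x + 1) ^ (2 * k) * ((x + 1) * (of_int Q - x + 1)))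
        ((x + 1) * (of_int Q - x + 1))"
      unfolding k by (simp add: ac_simps)
    from cong_ideal2_trans[OF cong_ideal2_sym[OF cong_ideal2_cmult[OF norm]]
        cong_ideal2_trans[OF this norm]]
    have "?C ((x + 1) ^ (2 * k) * of_int (Q + 2)) (of_int (Q + 2))" .
    then have "?C ((x + 1) ^ (2 * k)) 1"
      by - (rule cong_ideal2_cancel[OF cop], simp add: mult.commute)
    from cong_ideal2_trans[OF cong_ideal2_sym[OF sq] this]
    have "?C (of_int ((Q + 2) ^ k) * x ^ k) 1" .
    from cong_ideal2_trans[OF red this] have "?C (of_int s * x ^ k) 1" .
    from key[OF this] show ?thesis by (simp add: e k s_def)
  next
    \<comment> \<open>Frobenius sends \<open>x\<close> to its conjugate, so
      \<open>(x + 1) ^ (p + 1)\<close> is the norm \<open>Q + 2\<close>. Cancelling one factor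
      \<open>Q + 2\<close> leaves its exponent at \<open>k\<close>, as Euler's criterion requires,
      while \<open>x\<close> keeps exponent \<open>k + 1\<close>.\<close>
    assume e: "e = -1"
    have "?C (x ^ p) (of_int Q - x)"
      using frob by - (rule cong_ideal2_cancel[OF cop2], simp add: e algebra_simps)
    from cong_ideal2_trans[OF dream cong_ideal2_add[OF this cong_ideal2_refl]]
    have "?C ((x + 1) ^ p) (of_int Q - x + 1)" .
    then have "?C ((x + 1) * (x + 1) ^ p) ((x + 1) * (of_int Q - x + 1))"
      by (rule cong_ideal2_cmult)
    from cong_ideal2_trans[OF this norm] have "?C ((x + 1) ^ (2 * (k + 1))) (of_int (Q + 2))"
      by (simp add: k)
    from cong_ideal2_trans[OF cong_ideal2_sym[OF sq] this]
    have "?C (of_int ((Q + 2) ^ (k + 1)) * x ^ (k + 1)) (of_int (Q + 2))" .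
    then have "?C (of_int ((Q + 2) ^ k) * x ^ (k + 1)) 1"
      by - (rule cong_ideal2_cancel[OF cop], simp add: ac_simps)
    from cong_ideal2_trans[OF red this] have "?C (of_int s * x ^ (k + 1)) 1" .
    from key[OF this] show ?thesis
      by (simp add: e k s_def nat_add_distrib algebra_simps)
  qed
qed

section \<open>From polynomials to matrices\<close>

text \<open>Modulo \<open>m\<close>, 1 and \<open>x\<close> are independent in the quotient by a
  monic quadratic: a multiple of the quadratic that is linear modulo \<open>m\<close> must vanish
  modulo \<open>m\<close>.\<close>

lemma cong_ideal2_quadratic_linear:
  fixes m u v c Q :: int
  assumes "cong_ideal2 [:m:] [:1, -Q, 1:] [:v, u:] [:c:]"
  shows "m dvd u" "m dvd v - c"
proof -
  obtain h k where hk: "[:v, u:] - [:c:] = [:m:] * h + [:1, -Q, 1:] * k"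
    using assms unfolding cong_ideal2_def by blast
  have co: "Polynomial.coeff ([:v, u:] - [:c:]) n =
      m * Polynomial.coeff h n + Polynomial.coeff ([:1, -Q, 1:] * k) n" for n
    unfolding hk by simp
  \<comment> \<open>the quadratic is monic, so the coefficients of \<open>k\<close> vanish modulo \<open>m\<close> from the top down\<close>
  have "\<forall>n. n \<ge> d \<longrightarrow> m dvd Polynomial.coeff k n" for d
  proof (rule inc_induct[of d "max d (Suc (degree k))"])
    show "\<forall>n. n \<ge> max d (Suc (degree k)) \<longrightarrow> m dvd Polynomial.coeff k n"
      by (auto simp: coeff_eq_0)
  next
    fix d assume IH: "\<forall>n. n \<ge> Suc d \<longrightarrow> m dvd Polynomial.coeff k n"
    \<comment> \<open>The left side has degree at most 1, so its coefficient at \<open>d + 2\<close>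
      is zero; the leading term of the quadratic contributes coefficient \<open>d\<close> of
      \<open>k\<close> there.\<close>
    have "0 = m * Polynomial.coeff h (d + 2) +
        (Polynomial.coeff k (d + 2) - Q * Polynomial.coeff k (d + 1) +
          Polynomial.coeff k d)"
      using co[of "d + 2"] by (simp add: coeff_pCons)
    then have "Polynomial.coeff k d =
        m * (- Polynomial.coeff h (d + 2)) - Polynomial.coeff k (d + 2) + Q * Polynomial.coeff k (d + 1)"
      by (simp add: algebra_simps)
    moreover have "m dvd Polynomial.coeff k (d + 2)" "m dvd Polynomial.coeff k (d + 1)"
      using IH by auto
    ultimately have "m dvd Polynomial.coeff k d" by (metis dvd_add dvd_diff dvd_mult dvd_triv_left)
    then show "\<forall>n. n \<ge> d \<longrightarrow> m dvd Polynomial.coeff k n"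
      using IH by (metis le_neq_implies_less Suc_leI)
  qed auto
  then have k: "m dvd Polynomial.coeff k n" for n by blast
  have "v - c = m * Polynomial.coeff h 0 + Polynomial.coeff k 0"
    using co[of 0] by simp
  then show "m dvd v - c" using k[of 0] by simp
  have "u = m * Polynomial.coeff h 1 + (Polynomial.coeff k 1 - Q * Polynomial.coeff k 0)"
    using co[of 1] by (simp add: coeff_pCons)
  then show "m dvd u" using k by (metis dvd_add dvd_diff dvd_mult dvd_triv_left)
qed

text \<open>The pair \<open>(u, v)\<close> gives the remainder \<open>u x + v\<close> of
  \<open>x ^ n\<close> modulo \<open>x\<^sup>2 - Q x + 1\<close>; \<open>u\<close> is the Lucas
  sequence with parameters \<open>Q\<close> and 1.\<close>

fun lucas_coeffs :: "int \<Rightarrow> nat \<Rightarrow> int \<times> int" where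
  "lucas_coeffs Q 0 = (0, 1)"
| "lucas_coeffs Q (Suc n) = (case lucas_coeffs Q n of (u, v) \<Rightarrow> (Q * u + v, - u))"

lemma power_lucas_coeffs:
  assumes "lucas_coeffs Q n = (u, v)"
  shows "cong_ideal2 m [:1, -Q, 1:] ([:0, 1:] ^ n) [:v, u:]"
  using assms
proof (induction n arbitrary: u v)
  case 0
  then show ?case by (auto simp: one_pCons intro: cong_ideal2_refl)
next
  case (Suc n)
  obtain u' v' where uv: "lucas_coeffs Q n = (u', v')" by fastforce
  have "cong_ideal2 m [:1, -Q, 1:] ([:0, 1:] ^ Suc n) ([:0, 1:] * [:v', u':])"
    unfolding power_Suc by (rule cong_ideal2_cmult[OF Suc.IH[OF uv]])
  also have "cong_ideal2 m [:1, -Q, 1:] ([:0, 1:] * [:v', u':]) [:v, u:]"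
    \<comment> \<open>Multiplication by \<open>x\<close> creates the term
      \<open>u' x\<^sup>2\<close>, so the quotient in the division by the quadratic is
      \<open>u'\<close>.\<close>
    using Suc.prems uv by (intro cong_ideal2_dvd2 dvdI[of _ _ "[:u':]"]) auto
  finally show ?case .
qed

lemma lucas_coeffs_dvd:
  assumes "lucas_coeffs Q n = (u, v)"
    and "cong_ideal2 (of_int m) ([:0, 1:]\<^sup>2 - of_int Q * [:0, 1:] + 1) ([:0, 1:] ^ n)
      (of_int c :: int poly)"
  shows "m dvd u" "m dvd v - c"
proof -
  have "[:0, 1:]\<^sup>2 - of_int Q * [:0, 1:] + 1 = [:1, - Q, 1:]"
    by (simp add: of_int_poly power2_eq_square one_pCons)
  then have "cong_ideal2 [:m:] [:1, -Q, 1:] ([:0, 1:] ^ n) [:c:]"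
    using assms(2) by (simp add: of_int_poly)
  then have "cong_ideal2 [:m:] [:1, -Q, 1:] [:v, u:] [:c:]"
    using power_lucas_coeffs[OF assms(1)] cong_ideal2_trans cong_ideal2_sym by blast
  then show "m dvd u" "m dvd v - c" using cong_ideal2_quadratic_linear by blast+
qed

text \<open>Cayley--Hamilton read entrywise: powers of \<open>A\<close> obey the recursion of the
  remainders of \<open>x ^ n\<close>. Integer coefficients thus carry results from a commutative
  ring to matrices.\<close>

lemma matrix_power_lucas:
  fixes A :: "rat^2^2" and B :: "int^2^2"
  assumes p: "prime p"
    and B: "\<And>i j. has_residue p (A $ i $ j) (B $ i $ j)"
    and det: "[det B = 1] (mod int p)"
    and "lucas_coeffs (trace B) n = (u, v)"
  shows "has_residue p (matrix_power A n $ i $ j) (u * B $ i $ j + (if i = j then v else 0))"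
  using assms(4)
proof (induction n arbitrary: u v i j)
  case 0
  then show ?case
    using has_residue_of_int[of p 1] has_residue_of_int[of p 0]
    by (auto simp: matrix_power_def mat_def)
next
  case (Suc n)
  obtain u' v' where uv': "lucas_coeffs (trace B) n = (u', v')" by fastforce
  then have uv: "u = trace B * u' + v'" "v = - u'" using Suc.prems by auto
  have tr: "trace B = B $ 1 $ 1 + B $ 2 $ 2" by (simp add: trace_def sum_2)
  \<comment> \<open>The determinant of \<open>B\<close> is 1 only modulo \<open>p\<close>;
    \<open>t\<close> records the error, which reappears below as a multiple of \<open>p\<close> on
    the diagonal.\<close>
  obtain t where t: "B $ 1 $ 1 * B $ 2 $ 2 - B $ 1 $ 2 * B $ 2 $ 1 = 1 + int p * t"
    using det unfolding det_2 cong_iff_dvd_diff dvd_def by (metis diff_add_cancel add.commute)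
  let ?R = "\<lambda>l. u' * B $ l $ j + (if l = j then v' else 0)"
  have "has_residue p (A $ i $ 1 * matrix_power A n $ 1 $ j + A $ i $ 2 * matrix_power A n $ 2 $ j)
      (B $ i $ 1 * ?R 1 + B $ i $ 2 * ?R 2)"
    by (intro has_residue_add[OF p] has_residue_mult B Suc.IH[OF uv'])
  moreover have "matrix_power A (Suc n) $ i $ j =
      A $ i $ 1 * matrix_power A n $ 1 $ j + A $ i $ 2 * matrix_power A n $ 2 $ j"
    by (simp add: matrix_power_def matrix_matrix_mult_def sum_2)
  moreover have "B $ i $ 1 * ?R 1 + B $ i $ 2 * ?R 2 -
      (u * B $ i $ j + (if i = j then v else 0)) = (if i = j then int p * (- t * u') else 0)"
  proof -
    have T: "B $ 1 $ 2 * B $ 2 $ 1 = B $ 1 $ 1 * B $ 2 $ 2 - 1 - int p * t" using t by simp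
    have T': "u' * (B $ 1 $ 2 * B $ 2 $ 1) = u' * (B $ 1 $ 1 * B $ 2 $ 2 - 1 - int p * t)"
      using T by simp
    show ?thesis
      using exhaust_2[of i] exhaust_2[of j] T' uv tr by (auto simp: algebra_simps)
  qed
  then have "[B $ i $ 1 * ?R 1 + B $ i $ 2 * ?R 2 = u * B $ i $ j + (if i = j then v else 0)]
      (mod int p)"
    unfolding cong_iff_dvd_diff by simp
  ultimately show ?case using has_residue_cong by simp
qed

lemma mat_cong_mat:
  assumes "prime p" "has_residue p x c" "\<And>i j. has_residue p (M $ i $ j) (if i = j then c else 0)"
  shows "mat_cong p M (mat x)"
  unfolding mat_cong_def
proof (intro allI)
  fix i j
  have "has_residue p ((mat x :: rat^'a^'a) $ i $ j) (if i = j then c else 0)"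
    using assms(2) has_residue_of_int[of p 0] by (simp add: mat_def)
  then show "rat_cong p (M $ i $ j) (mat x $ i $ j)"
    using rat_congI[OF assms(1) assms(3)] by blast
qed

section \<open>The congruences for the rational matrix \<open>A\<close>\<close>

theorem theorem8:
  fixes A :: "rat^2^2" and q \<delta> :: rat and p :: nat
  assumes "det A = 1"
    and "trace A = q"
    and "prime p" and "odd p"
    and "p \<notin> denom_primes q"
    and "\<forall>i j. p \<notin> denom_primes (A $ i $ j)"
    and "\<delta> = q^2 - 4"
  shows "(rat_Legendre \<delta> p \<noteq> 0 \<longrightarrow>
            mat_cong p (matrix_power A (nat ((int p - rat_Legendre \<delta> p) div 2)))
                       (mat (of_int (rat_Legendre (q + 2) p)))) \<and>
         (rat_Legendre \<delta> p = 0 \<longrightarrow>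
            mat_cong p (matrix_power A p) (mat (q / 2)) \<and>
            (mat_cong p (mat (q / 2) :: rat^2^2) (mat 1) \<or>
             mat_cong p (mat (q / 2) :: rat^2^2) (- mat 1)))"
proof -
  note p = assms(3,4)
  have "\<forall>i j. \<exists>c. has_residue p (A $ i $ j) c"
    using has_residue_exists[OF p(1)] assms(6) by blast
  then obtain b where b: "\<And>i j. has_residue p (A $ i $ j) (b i j)" by metis
  define B :: "int^2^2" where "B = (\<chi> i j. b i j)"
  have B: "has_residue p (A $ i $ j) (B $ i $ j)" for i j using b by (simp add: B_def)
  define Q where "Q = trace B"
  have q: "has_residue p q Q"
    unfolding Q_def assms(2)[symmetric] trace_def sum_2 by (intro has_residue_add p B)
  have "has_residue p (det A) (det B)"
    unfolding det_2 by (intro has_residue_diff has_residue_mult p B)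
  then have det: "[det B = 1] (mod int p)"
    using has_residue_unique[OF p(1)] has_residue_of_int[of p 1] assms(1) by simp
  have \<delta>: "has_residue p \<delta> (Q\<^sup>2 - 4)"
    using has_residue_diff[OF p(1) has_residue_mult[OF q q] has_residue_of_int[of p 4]]
    by (simp add: assms(7) power2_eq_square)
  have q2: "has_residue p (q + 2) (Q + 2)"
    using has_residue_add[OF p(1) q has_residue_of_int[of p 2]] by simp
  note L\<delta> = rat_Legendre_eq[OF p(1) \<delta>] and Lq = rat_Legendre_eq[OF p(1) q2]
  let ?X = "[:0, 1:] :: int poly"
  let ?C = "cong_ideal2 (of_int (int p)) (?X\<^sup>2 - of_int Q * ?X + 1)"
  \<comment> \<open>A power of the indeterminate that is constant in the quotient ring has
    \<open>u\<close> divisible by \<open>p\<close> and \<open>v\<close> congruent to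
    \<open>c\<close>, so the matrix power is scalar modulo \<open>p\<close>.\<close>
  have transfer: "mat_cong p (matrix_power A n) (mat x)"
    if "?C (?X ^ n) (of_int c)" "has_residue p x c" for n c x
  proof (rule mat_cong_mat[OF p(1) that(2)])
    fix i j
    obtain u v where uv: "lucas_coeffs Q n = (u, v)" by fastforce
    note d = lucas_coeffs_dvd[OF uv that(1)]
    have "[u * B $ i $ j + (if i = j then v else 0) = 0 * B $ i $ j + (if i = j then c else 0)]
        (mod int p)"
      using d by (intro cong_add cong_mult) (auto simp: cong_0_iff cong_iff_dvd_diff)
    then show "has_residue p (matrix_power A n $ i $ j) (if i = j then c else 0)"
      using has_residue_cong[OF matrix_power_lucas[OF p(1) B det uv[unfolded Q_def]]] by simp
  qed
  show ?thesis
  proof (intro conjI impI)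
    assume "rat_Legendre \<delta> p \<noteq> 0"
    then show "mat_cong p (matrix_power A (nat ((int p - rat_Legendre \<delta> p) div 2)))
        (mat (of_int (rat_Legendre (q + 2) p)))"
      unfolding L\<delta> Lq
      by (intro transfer[OF _ has_residue_of_int] quadratic_half_power[OF p])
  next
    assume "rat_Legendre \<delta> p = 0"
    then have L0: "Legendre (Q\<^sup>2 - 4) (int p) = 0" using L\<delta> by simp
    \<comment> \<open>An integer residue of \<open>q / 2\<close>, with \<open>(p + 1) div 2\<close>
      as the inverse of 2.\<close>
    define t where "t = Q * ((int p + 1) div 2)"
    have t: "has_residue p (q / 2) t" unfolding t_def using has_residue_half[OF p(2) q] .
    have "2 * ((int p + 1) div 2) = int p + 1" using p(2) by (intro dvd_mult_div_cancel) simp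
    then have "2 * t - Q = int p * Q"
      unfolding t_def by (simp add: algebra_simps)
    then have tQ: "[2 * t = Q] (mod int p)" unfolding cong_iff_dvd_diff by simp
    have cop2: "coprime 2 (int p)" using p(2) by simp
    have "?C (2 * ?X ^ p) (of_int Q)"
      using quadratic_frobenius[OF p, where x = ?X and Q = Q] L0 by simp
    also have "?C (of_int Q) (of_int (2 * t))"
      using tQ by (intro cong_ideal2_of_int) (rule cong_sym)
    finally have "?C (?X ^ p) (of_int t)"
      by - (rule cong_ideal2_cancel[OF cop2], simp)
    then show "mat_cong p (matrix_power A p) (mat (q / 2))" using t by (rule transfer)
    \<comment> \<open>Modulo \<open>p\<close>, \<open>4 t\<^sup>2\<close> agrees with
      \<open>Q\<^sup>2\<close> and hence with 4. Cancelling 4 shows that \<open>t\<close> is a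
      square root of 1 modulo a prime, thus 1 or -1.\<close>
    have "int p dvd Q\<^sup>2 - 4" using L0 Legendre_eq_0_iff by blast
    moreover have "int p dvd (2 * t)\<^sup>2 - Q\<^sup>2"
      using cong_pow[OF tQ, of 2] cong_iff_dvd_diff by blast
    ultimately have "int p dvd ((2 * t)\<^sup>2 - Q\<^sup>2) + (Q\<^sup>2 - 4)" by (rule dvd_add[rotated])
    moreover have "((2 * t)\<^sup>2 - Q\<^sup>2) + (Q\<^sup>2 - 4) = 2 * (2 * ((t - 1) * (t + 1)))"
      by (simp add: power2_eq_square algebra_simps)
    ultimately have "int p dvd (t - 1) * (t + 1)"
      using cop2 by (metis coprime_commute coprime_dvd_mult_right_iff)
    then have "int p dvd t - 1 \<or> int p dvd t - (-1)"
      using p(1) by (simp add: prime_dvd_mult_iff)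
    then have "[t = 1] (mod int p) \<or> [t = -1] (mod int p)"
      unfolding cong_iff_dvd_diff .
    then have r: "has_residue p (q / 2) 1 \<or> has_residue p (q / 2) (-1)"
      using has_residue_cong[OF t] by blast
    have m: "mat_cong p (mat (q / 2) :: rat^2^2) (mat (of_int c))"
      if "has_residue p (q / 2) c" for c
      using that has_residue_of_int[of p 0]
      by (intro mat_cong_mat[OF p(1) has_residue_of_int]) (simp add: mat_def)
    have "(mat (of_int (-1)) :: rat^2^2) = - mat 1"
      by (simp add: mat_def vec_eq_iff)
    then show "mat_cong p (mat (q / 2) :: rat^2^2) (mat 1) \<or>
        mat_cong p (mat (q / 2) :: rat^2^2) (- mat 1)"
      using r m[of 1] m[of "-1"] by auto
  qed
qed

end
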